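(* Let $\Omega$ be an infinite set. For a function $f:\Omega\to\Omega$ the following conditions are equivalent: (1) $f$ is a near-bijection and $\mathrm{ind}(f)=0$; (2) $f$ is almost bijective.
   Context: For $A\subseteq\Omega$ write $A'=\Omega\setminus A$; $A$ is cofinite if $A'$ is finite. $|A|$ denotes the cardinality of a finite set $A$. A function $f:\Omega\to\Omega$ is almost bijective if there is a bijection $g:\Omega\to\Omega$ such that $\{\omega\in\Omega: f(\omega)\neq g(\omega)\}$ is finite. It is a near-bijection if there exist cofinite subsets $A,B\subseteq\Omega$ such that $f$ restricts to a bijection $A\to B$. The range of $f$ is $f(\Omega)=\{f(\omega):\omega\in\Omega\}$ and the monoset of $f$ is $\Omega_f=\{\omega\in\Omega:\ f^{-1}(\{f(\omega)\})=\{\omega\}\}$, where $f^{-1}(B)$ denotes the preimage of $B$. A function $f$ is a near-bijection if and only if both $f(\Omega)'$ and $\Omega_f'$ are finite; for a near-bijection the index is the integer $\mathrm{ind}(f)=\big(|\Omega_f'|-|f(\Omega_f')|\big)-|f(\Omega)'|$. *)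

theory Defs
  imports "HOL-Library.FuncSet"
begin

(* A function from Omega to Omega is any f with f \<in> Omega \<rightarrow> Omega. Its values outside
   Omega are arbitrary, and no definition below depends on them. *)

definition cofinite_in :: "'a set \<Rightarrow> 'a set \<Rightarrow> bool" where
  "cofinite_in \<Omega> A \<longleftrightarrow> A \<subseteq> \<Omega> \<and> finite (\<Omega> - A)"

definition almost_bijective :: "'a set \<Rightarrow> ('a \<Rightarrow> 'a) \<Rightarrow> bool" where
  "almost_bijective \<Omega> f \<longleftrightarrow> (\<exists>g. bij_betw g \<Omega> \<Omega> \<and> finite {w \<in> \<Omega>. f w \<noteq> g w})"

definition near_bijection :: "'a set \<Rightarrow> ('a \<Rightarrow> 'a) \<Rightarrow> bool" where
  "near_bijection \<Omega> f \<longleftrightarrow> (\<exists>A B. cofinite_in \<Omega> A \<and> cofinite_in \<Omega> B \<and> bij_betw f A B)"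

definition monoset :: "'a set \<Rightarrow> ('a \<Rightarrow> 'a) \<Rightarrow> 'a set" where
  "monoset \<Omega> f = {w \<in> \<Omega>. f -` {f w} \<inter> \<Omega> = {w}}"

(* Meaningful only for near-bijections, where the three sets are finite; the subtractions
   are those of the integers. *)
definition near_index :: "'a set \<Rightarrow> ('a \<Rightarrow> 'a) \<Rightarrow> int" where
  "near_index \<Omega> f =
     (int (card (\<Omega> - monoset \<Omega> f)) - int (card (f ` (\<Omega> - monoset \<Omega> f))))
       - int (card (\<Omega> - f ` \<Omega>))"

end

theory Submission
  imports Defs
begin

text \<open>
  The index of a near-bijection can be read off from any way of realising it as one: if \<open>f\<close>
  restricts to a bijection between cofinite sets \<open>A\<close> and \<open>B\<close>, then the index is
  \<open>|\<Omega> - A| - |\<Omega> - B|\<close> (lemma \<open>near_index_eq\<close>). Index zero therefore says precisely that the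
  two finite complements are equinumerous, so that the bijection \<open>A \<rightarrow> B\<close> can be completed to a
  permutation of \<open>\<Omega>\<close> by changing \<open>f\<close> on the finite set \<open>\<Omega> - A\<close> only. Conversely, if \<open>f\<close> agrees
  with a permutation \<open>g\<close> off a finite set, then \<open>f\<close> is a bijection from the agreement set \<open>A\<close>
  to \<open>g ` A\<close>, and \<open>g\<close> maps \<open>\<Omega> - A\<close> bijectively onto \<open>\<Omega> - g ` A\<close>.
\<close>

text \<open>
  A point of \<open>A\<close> outside the monoset shares its value with a point of \<open>\<Omega> - A\<close>, since \<open>f\<close> is
  injective on \<open>A\<close>; a finite set of values is attained on \<open>A\<close> only finitely often.
\<close>
lemma finite_non_monoset:
  assumes "finite (\<Omega> - A)" and "inj_on f A"
  shows "finite (\<Omega> - monoset \<Omega> f)"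
proof -
  have "\<Omega> - monoset \<Omega> f \<subseteq> (\<Omega> - A) \<union> (f -` (f ` (\<Omega> - A)) \<inter> A)"
  proof
    fix x assume x: "x \<in> \<Omega> - monoset \<Omega> f"
    then obtain y where y: "y \<in> \<Omega>" "f y = f x" "y \<noteq> x"
      by (auto simp: monoset_def)
    show "x \<in> (\<Omega> - A) \<union> (f -` (f ` (\<Omega> - A)) \<inter> A)"
    proof (cases "x \<in> A")
      case True
      with y assms(2) have "y \<notin> A" by (auto dest: inj_onD)
      with y have "f x \<in> f ` (\<Omega> - A)" by (metis DiffI image_eqI)
      with True show ?thesis by simp
    qed (use x in auto)
  qed
  moreover have "finite (f -` (f ` (\<Omega> - A)) \<inter> A)"
    using assms by (intro finite_vimage_IntI) auto
  ultimately show ?thesis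
    using assms(1) by (meson finite_UnI finite_subset)
qed

text \<open>
  Both complements are counted by splitting along the monoset \<open>M\<close> and its complement \<open>N\<close>, which
  have disjoint images. On \<open>M\<close> the points outside \<open>A\<close> are matched one to one with the values
  missed by \<open>A\<close>, and the \<open>|A \<inter> N|\<close> points of \<open>N\<close> that lie in \<open>A\<close> have as many values, so these
  contributions cancel in the difference.
\<close>
lemma near_index_eq:
  assumes maps: "f \<in> \<Omega> \<rightarrow> \<Omega>"
    and A: "cofinite_in \<Omega> A" and B: "cofinite_in \<Omega> B" and bij: "bij_betw f A B"
  shows "near_index \<Omega> f = int (card (\<Omega> - A)) - int (card (\<Omega> - B))"
proof -
  define M N where "M = monoset \<Omega> f" and "N = \<Omega> - monoset \<Omega> f"
  have inj: "inj_on f A" and fA: "B = f ` A"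
    using bij by (auto simp: bij_betw_def)
  have AO: "A \<subseteq> \<Omega>" and finA: "finite (\<Omega> - A)" and finB: "finite (\<Omega> - B)"
    using A B by (auto simp: cofinite_in_def)
  have finN: "finite N"
    unfolding N_def using finA inj by (rule finite_non_monoset)
  have MO: "M \<subseteq> \<Omega>" by (auto simp: M_def monoset_def)
  have ON: "\<Omega> = M \<union> N" and MN: "M \<inter> N = {}"
    using MO by (auto simp: M_def N_def)
  have sep: "x = y" if "x \<in> M" "y \<in> \<Omega>" "f x = f y" for x y
    using that by (auto simp: M_def monoset_def)
  have split_B: "\<Omega> - B = (\<Omega> - f ` \<Omega>) \<union> (f ` (M - A) \<union> (f ` N - f ` (A \<inter> N)))"
  proof
    show "\<Omega> - B \<subseteq> (\<Omega> - f ` \<Omega>) \<union> (f ` (M - A) \<union> (f ` N - f ` (A \<inter> N)))"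
      using ON fA by blast
    show "(\<Omega> - f ` \<Omega>) \<union> (f ` (M - A) \<union> (f ` N - f ` (A \<inter> N))) \<subseteq> \<Omega> - B"
    proof (intro Un_least)
      show "\<Omega> - f ` \<Omega> \<subseteq> \<Omega> - B" using AO fA by blast
      show "f ` (M - A) \<subseteq> \<Omega> - B"
      proof
        fix z assume "z \<in> f ` (M - A)"
        then obtain m where m: "m \<in> M" "m \<notin> A" "z = f m" by blast
        then have "z \<notin> B" using sep[of m] AO fA by blast
        moreover have "z \<in> \<Omega>" using m MO maps by auto
        ultimately show "z \<in> \<Omega> - B" by blast
      qed
      show "f ` N - f ` (A \<inter> N) \<subseteq> \<Omega> - B"
      proof
        fix z assume z: "z \<in> f ` N - f ` (A \<inter> N)"
        then obtain n where n: "n \<in> N" "z = f n" by blast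
        have False if "a \<in> A" "z = f a" for a
        proof -
          have "a \<notin> N" using z that by blast
          then have "a \<in> M" using that(1) AO ON by blast
          then have "a = n" using sep[of a n] n that(2) ON by auto
          with \<open>a \<notin> N\<close> n show False by simp
        qed
        moreover have "z \<in> \<Omega>" using n maps ON by auto
        ultimately show "z \<in> \<Omega> - B" using fA by blast
      qed
    qed
  qed
  have finMA: "finite (M - A)" using finA MO by (meson Diff_mono finite_subset order_refl)
  have "inj_on f (M - A)"
    using sep MO by (auto intro!: inj_onI)
  then have card_M: "card (f ` (M - A)) = card (M - A)" by (rule card_image)
  have "inj_on f (A \<inter> N)" using inj by (rule inj_on_subset) simp
  then have "card (f ` N - f ` (A \<inter> N)) = card (f ` N) - card (A \<inter> N)"
    using finN by (subst card_Diff_subset) (auto simp: card_image)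
  moreover have "card (A \<inter> N) \<le> card (f ` N)"
    using \<open>inj_on f (A \<inter> N)\<close> finN
    by (metis card_image card_mono finite_imageI image_mono inf_le2)
  ultimately have card_N:
    "int (card (f ` N - f ` (A \<inter> N))) = int (card (f ` N)) - int (card (A \<inter> N))"
    by simp
  have disj: "f ` (M - A) \<inter> (f ` N - f ` (A \<inter> N)) = {}"
    using sep ON MN by blast
  have "finite (\<Omega> - f ` \<Omega>)"
    using finB AO fA by (meson Diff_mono finite_subset image_mono order_refl)
  moreover have "(\<Omega> - f ` \<Omega>) \<inter> (f ` (M - A) \<union> (f ` N - f ` (A \<inter> N))) = {}"
    using ON by blast
  ultimately have card_B: "card (\<Omega> - B) =
      card (\<Omega> - f ` \<Omega>) + (card (f ` (M - A)) + card (f ` N - f ` (A \<inter> N)))"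
    unfolding split_B using finMA finN disj by (simp add: card_Un_disjoint)
  have "\<Omega> - A = (M - A) \<union> (N - A)" using ON by blast
  then have "card (\<Omega> - A) = card (M - A) + card (N - A)"
    using finMA finN MN by (simp add: card_Un_disjoint disjoint_iff)
  moreover have "card N = card (A \<inter> N) + card (N - A)"
    using card_Int_Diff[OF finN, of A] by (simp add: Int_commute)
  ultimately show ?thesis
    using card_B card_M card_N by (simp add: near_index_def flip: N_def)
qed

theorem mainTheorem1:
  fixes \<Omega> :: "'a set" and f :: "'a \<Rightarrow> 'a"
  assumes "infinite \<Omega>"
    and "f \<in> \<Omega> \<rightarrow> \<Omega>"
  shows "(near_bijection \<Omega> f \<and> near_index \<Omega> f = 0) \<longleftrightarrow> almost_bijective \<Omega> f"
proof
  assume near: "near_bijection \<Omega> f \<and> near_index \<Omega> f = 0"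
  then obtain A B where A: "cofinite_in \<Omega> A" and B: "cofinite_in \<Omega> B" and bij: "bij_betw f A B"
    by (auto simp: near_bijection_def)
  have sub: "A \<subseteq> \<Omega>" "B \<subseteq> \<Omega>" and fin: "finite (\<Omega> - A)" "finite (\<Omega> - B)"
    using A B by (auto simp: cofinite_in_def)
  have "card (\<Omega> - A) = card (\<Omega> - B)"
    using near near_index_eq[OF assms(2) A B bij] by simp
  then obtain h where h: "bij_betw h (\<Omega> - A) (\<Omega> - B)"
    using fin finite_same_card_bij by blast
  define g where "g = (\<lambda>w. if w \<in> A then f w else h w)"
  have "bij_betw g (A \<union> (\<Omega> - A)) (B \<union> (\<Omega> - B))"
    unfolding g_def using bij h by (intro bij_betw_disjoint_Un) auto
  moreover have "A \<union> (\<Omega> - A) = \<Omega>" "B \<union> (\<Omega> - B) = \<Omega>" using sub by auto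
  ultimately have "bij_betw g \<Omega> \<Omega>" by simp
  moreover have "finite {w \<in> \<Omega>. f w \<noteq> g w}"
    by (rule finite_subset[OF _ fin(1)]) (auto simp: g_def)
  ultimately show "almost_bijective \<Omega> f"
    unfolding almost_bijective_def by blast
next
  assume "almost_bijective \<Omega> f"
  then obtain g where g: "bij_betw g \<Omega> \<Omega>" and fin: "finite {w \<in> \<Omega>. f w \<noteq> g w}"
    by (auto simp: almost_bijective_def)
  define A where "A = {w \<in> \<Omega>. f w = g w}"
  have AO: "A \<subseteq> \<Omega>" by (auto simp: A_def)
  have "\<Omega> - A = {w \<in> \<Omega>. f w \<noteq> g w}" by (auto simp: A_def)
  with fin have finA: "finite (\<Omega> - A)" by simp
  have inj: "inj_on g \<Omega>" and surj: "g ` \<Omega> = \<Omega>" using g by (auto simp: bij_betw_def)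
  have img: "g ` (\<Omega> - A) = \<Omega> - g ` A"
    using inj_on_image_set_diff[OF inj, of \<Omega> A] AO surj by simp
  have A: "cofinite_in \<Omega> A" using AO finA by (simp add: cofinite_in_def)
  have "finite (\<Omega> - g ` A)" using finA by (simp flip: img)
  then have B: "cofinite_in \<Omega> (g ` A)" using AO surj by (auto simp: cofinite_in_def)
  have "bij_betw g A (g ` A)"
    using inj AO by (meson inj_on_imp_bij_betw inj_on_subset)
  then have bij: "bij_betw f A (g ` A)"
    by (subst bij_betw_cong[of A f g]) (auto simp: A_def)
  have "card (\<Omega> - g ` A) = card (\<Omega> - A)"
    unfolding img[symmetric] by (intro card_image inj_on_subset[OF inj]) auto
  then have "near_index \<Omega> f = 0"
    using near_index_eq[OF assms(2) A B bij] by simp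
  moreover have "near_bijection \<Omega> f"
    unfolding near_bijection_def using A B bij by blast
  ultimately show "near_bijection \<Omega> f \<and> near_index \<Omega> f = 0" by simp
qed

end
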